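(* Let $p_\theta$, $\theta\in\Theta\subseteq\mathbb R$, be the probability mass function of a real observation $S$, having a continuous derivative with respect to $\theta$. For each $s\in\mathcal S_0$, assume that the function $$\gamma_s(\theta)=\left(\frac{\partial p_\theta(s)}{\partial\theta}\right)\Big/\left(-\frac{\partial F_\theta(s)}{\partial\theta}\right)=\left(\frac{\partial p_\theta(s)}{\partial\theta}\right)\Big/h_s(\theta)$$ is decreasing on $\Theta$. Then $H_s(\theta)<H_s^G(\theta)<H_s^\ell(\theta)$ uniformly on $\Theta$ (i.e. for every $\theta\in\Theta$).
   Context: $S$ is discrete with distribution function $F_\theta(s)=\Pr_\theta\{S\le s\}$, and $\Theta$ is an open interval. The right fiducial distribution function is $H_s(\theta)=1-F_\theta(s)=\Pr_\theta\{S>s\}$ and the left fiducial distribution function is $H_s^\ell(\theta)=1-\Pr_\theta\{S<s\}=\Pr_\theta\{S\ge s\}$. $\mathcal S_0$ is the set of those $s$ for which both can be defined, i.e. both $H_s$ and $H_s^\ell$ are distribution functions in $\theta$ on $\Theta$ (increasing and differentiable, with limits $0$ and $1$ as $\theta\to\inf\Theta$ and $\theta\to\sup\Theta$). Their densities are $h_s(\theta)=\frac{\partial}{\partial\theta}H_s(\theta)=-\frac{\partial}{\partial\theta}F_\theta(s)$, which is taken to be positive on $\Theta$ so that $\gamma_s$ is well defined, and $h_s^\ell(\theta)=\frac{\partial}{\partial\theta}H_s^\ell(\theta)=h_s(\theta)+\frac{\partial}{\partial\theta}p_\theta(s)$. The geometric mean fiducial density is $h_s^G(\theta)=c^{-1}(h_s(\theta)h_s^\ell(\theta))^{1/2}$,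 where $c=\int_\Theta(h_s(\theta)h_s^\ell(\theta))^{1/2}d\theta$, and $H_s^G$ is the corresponding distribution function. *)

theory Defs
  imports "HOL-Probability.Probability"
begin

text \<open>
  The model is a family \<open>p :: real \<Rightarrow> real pmf\<close> of discrete distributions of a real
  observation. The parameter space is an open interval with possibly infinite end points,
  written \<open>einterval a b\<close> with \<open>a < b\<close> of type \<open>ereal\<close>; the values \<open>p \<theta>\<close> for \<open>\<theta>\<close> outside it
  play no role.
\<close>

definition right_fiducial :: "(real \<Rightarrow> real pmf) \<Rightarrow> real \<Rightarrow> real \<Rightarrow> real"
  where "right_fiducial p s \<theta> = 1 - cdf (measure_pmf (p \<theta>)) s"

definition left_fiducial :: "(real \<Rightarrow> real pmf) \<Rightarrow> real \<Rightarrow> real \<Rightarrow> real"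
  where "left_fiducial p s \<theta> = 1 - measure_pmf.prob (p \<theta>) {..<s}"

text \<open>
  Distribution functions in the parameter are strictly increasing. If \<open>left_fiducial p s\<close> were
  allowed to reach 1 inside the interval, it would agree with \<open>geom_fiducial\<close> from there on.
\<close>

definition df_on :: "ereal \<Rightarrow> ereal \<Rightarrow> (real \<Rightarrow> real) \<Rightarrow> bool"
  where "df_on a b H \<longleftrightarrow>
    strict_mono_on (einterval a b) H \<and>
    H differentiable_on einterval a b \<and>
    ((H \<circ> real_of_ereal) \<longlongrightarrow> 0) (at_right a) \<and>
    ((H \<circ> real_of_ereal) \<longlongrightarrow> 1) (at_left b)"

text \<open>
  The set \<open>S\<^sub>0\<close>. An \<open>s\<close> is understood to be a value that the observation can take. For an \<open>s\<close>
  that has probability zero under every parameter the left and right distribution functions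
  coincide, \<open>fid_gamma\<close> below is constantly zero, and no strict inequality between them can hold.
\<close>

definition fiducial_points :: "ereal \<Rightarrow> ereal \<Rightarrow> (real \<Rightarrow> real pmf) \<Rightarrow> real set"
  where "fiducial_points a b p =
    {s \<in> (\<Union>\<theta>\<in>einterval a b. set_pmf (p \<theta>)).
       df_on a b (right_fiducial p s) \<and> df_on a b (left_fiducial p s)}"

definition right_density :: "(real \<Rightarrow> real pmf) \<Rightarrow> real \<Rightarrow> real \<Rightarrow> real"
  where "right_density p s \<theta> = deriv (right_fiducial p s) \<theta>"

definition left_density :: "(real \<Rightarrow> real pmf) \<Rightarrow> real \<Rightarrow> real \<Rightarrow> real"
  where "left_density p s \<theta> = deriv (left_fiducial p s) \<theta>"

definition fid_gamma :: "(real \<Rightarrow> real pmf) \<Rightarrow> real \<Rightarrow> real \<Rightarrow> real"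
  where "fid_gamma p s \<theta> = deriv (\<lambda>t. pmf (p t) s) \<theta> / right_density p s \<theta>"

definition geom_const :: "ereal \<Rightarrow> ereal \<Rightarrow> (real \<Rightarrow> real pmf) \<Rightarrow> real \<Rightarrow> real"
  where "geom_const a b p s =
    (LBINT \<theta>=a..b. sqrt (right_density p s \<theta> * left_density p s \<theta>))"

definition geom_density :: "ereal \<Rightarrow> ereal \<Rightarrow> (real \<Rightarrow> real pmf) \<Rightarrow> real \<Rightarrow> real \<Rightarrow> real"
  where "geom_density a b p s \<theta> =
    sqrt (right_density p s \<theta> * left_density p s \<theta>) / geom_const a b p s"

definition geom_fiducial :: "ereal \<Rightarrow> ereal \<Rightarrow> (real \<Rightarrow> real pmf) \<Rightarrow> real \<Rightarrow> real \<Rightarrow> real"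
  where "geom_fiducial a b p s \<theta> = (LBINT t=a..ereal \<theta>. geom_density a b p s t)"

end

theory Submission
  imports Defs
begin

text \<open>
  Write \<open>h\<close> and \<open>l\<close> for the right and left fiducial densities and put \<open>\<psi> = sqrt (1 + \<gamma>)\<close>. Since the
  left distribution function exceeds the right one by \<open>p\<^sub>\<theta>(s)\<close>, differentiation gives
  \<open>l = h (1 + \<gamma>)\<close>, so the three densities are \<open>h\<close>, \<open>h \<psi> / c\<close> and \<open>h \<psi>\<^sup>2\<close>. Each of them divided by
  the preceding one is \<open>\<psi>\<close> up to a constant factor, hence decreasing: the densities are ordered by
  likelihood ratio, and this order implies the order of the distribution functions.

  The second implication is \<open>interval_integral_antimono_weight_pos\<close>. The difference of two
  consecutive densities is a positive weight (\<open>h\<close>, respectively \<open>h \<psi>\<close>) times a decreasing function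
  (\<open>\<psi> / c - 1\<close>, respectively \<open>\<psi> - 1 / c\<close>), and its integral over the whole parameter interval
  is zero. Such an integrand is first positive and then negative, so its primitive rises from zero
  and then falls back to zero, and is positive in between, unless the integrand vanishes identically.

  Two degenerate cases have to be excluded for the inequalities to be strict. The weight \<open>h \<psi>\<close> must
  not vanish (\<open>left_density_pos\<close>), and \<open>\<psi>\<close> must not be constant (\<open>fid_gamma_not_constant\<close>): the
  limits at the two ends of the parameter interval would then force \<open>p\<^sub>\<theta>(s) = 0\<close> for all
  \<open>\<theta>\<close>, although \<open>s\<close> is a possible value of the observation.

  The density \<open>h\<close> is only known to be a derivative, with no continuity. This is why the fundamental
  theorem of calculus is proved below in a form that asks only for a nonnegative integrand
  (\<open>interval_integral_FTC_nonneg_derivative\<close>).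
\<close>

section \<open>Derivatives as densities\<close>

text \<open>
  A derivative is a pointwise limit of difference quotients of a continuous function. Cutting both
  the function and the quotients off outside the open set keeps them Borel measurable on the whole
  line, and near a point of the set the cut-off is not visible.
\<close>

lemma set_borel_measurable_has_derivative:
  fixes f F :: "real \<Rightarrow> real"
  assumes "open S" and F: "\<And>x. x \<in> S \<Longrightarrow> DERIV F x :> f x"
  shows "set_borel_measurable lborel S f"
proof -
  have S: "S \<in> sets borel"
    using \<open>open S\<close> by simp
  have "continuous_on S F"
    using F by (intro DERIV_continuous_on) (auto intro: has_field_derivative_at_within)
  define G where "G x = indicator S x * F x" for x
  have [measurable]: "G \<in> borel_measurable borel"
    using borel_measurable_continuous_on_indicator[OF S \<open>continuous_on S F\<close>]
    by (simp add: G_def[abs_def])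
  define q where "q n x = indicator S x * ((G (x + 1 / real (Suc n)) - G x) / (1 / real (Suc n)))"
    for n x
  have q: "q n \<in> borel_measurable borel" for n
    unfolding q_def using S by measurable
  have "(\<lambda>n. q n x) \<longlonglongrightarrow> indicator S x *\<^sub>R f x" for x
  proof (cases "x \<in> S")
    case True
    have "\<forall>\<^sub>F y in nhds x. F y = G y"
      using \<open>open S\<close> True by (auto simp: eventually_nhds G_def intro!: exI[of _ S])
    then have "DERIV G x :> f x"
      using DERIV_cong_ev[of x x F G "f x" "f x"] F[OF True] by simp
    then have "(\<lambda>h. (G (x + h) - G x) / h) \<midarrow>0\<rightarrow> f x"
      by (simp add: DERIV_def)
    moreover have "filterlim (\<lambda>n. 1 / real (Suc n)) (at 0) sequentially"
      using LIMSEQ_Suc[OF lim_1_over_n[where 'a = real]] by (simp add: filterlim_at)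
    ultimately have "(\<lambda>n. (G (x + 1 / real (Suc n)) - G x) / (1 / real (Suc n))) \<longlonglongrightarrow> f x"
      by (rule filterlim_compose)
    then show ?thesis
      using True by (simp add: q_def)
  qed (simp add: q_def)
  then have "(\<lambda>x. indicator S x *\<^sub>R f x) \<in> borel_measurable borel"
    by (rule borel_measurable_LIMSEQ_real[OF _ q])
  then show ?thesis
    by (simp add: set_borel_measurable_def)
qed

text \<open>
  On compact intervals a nonnegative Borel measurable derivative is Lebesgue integrable, whether or
  not it is continuous. Monotone convergence along an exhaustion by compact intervals extends this
  to open intervals with finite or infinite end points.
\<close>

lemma interval_integral_FTC_nonneg_derivative:
  fixes f F :: "real \<Rightarrow> real" and a b :: ereal
  assumes "a < b"
  assumes F: "\<And>x. x \<in> einterval a b \<Longrightarrow> DERIV F x :> f x"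
  assumes f_nonneg: "\<And>x. x \<in> einterval a b \<Longrightarrow> 0 \<le> f x"
  assumes A: "((F \<circ> real_of_ereal) \<longlongrightarrow> A) (at_right a)"
  assumes B: "((F \<circ> real_of_ereal) \<longlongrightarrow> B) (at_left b)"
  shows "set_integrable lborel (einterval a b) f" (is ?int)
    and "(LBINT x=a..b. f x) = B - A" (is ?eq)
proof -
  obtain u l where approx:
    "einterval a b = (\<Union>i. {l i .. u i})"
    "incseq u" "decseq l" "\<And>i. l i < u i" "\<And>i. a < l i" "\<And>i. u i < b"
    "l \<longlonglongrightarrow> a" "u \<longlonglongrightarrow> b"
    by (blast intro: einterval_Icc_approximation[OF \<open>a < b\<close>])
  let ?g = "\<lambda>x. indicator (einterval a b) x * f x"
  have meas: "set_borel_measurable lborel (einterval a b) f"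
    using F by (intro set_borel_measurable_has_derivative) auto
  then have g: "?g \<in> borel_measurable borel"
    by (simp add: set_borel_measurable_def)
  have sub: "x \<in> einterval a b" if "l i \<le> x" "x \<le> u i" for i x
    using approx(1) that by auto
  have bochner: "has_bochner_integral lborel (\<lambda>x. ?g x * indicator {l i..u i} x) (F (u i) - F (l i))" for i
  proof (rule has_bochner_integral_FTC_Icc_nonneg[OF g])
    fix x assume "x \<in> {l i..u i}"
    then have "x \<in> einterval a b"
      using sub by auto
    then show "DERIV F x :> ?g x" "0 \<le> ?g x"
      using F f_nonneg by simp_all
  qed (use approx(4)[of i] in simp)
  moreover have "?g x * indicator {l i..u i} x = indicator {l i..u i} x *\<^sub>R f x" for i x
    using sub by (auto simp: indicator_def)
  ultimately have bochner': "has_bochner_integral lborel (\<lambda>x. indicator {l i..u i} x *\<^sub>R f x) (F (u i) - F (l i))" for i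
    by simp
  have int: "set_integrable lborel {l i..u i} f" for i
    using bochner' by (auto simp: set_integrable_def has_bochner_integral_iff)
  have FTC: "(LBINT x=l i..u i. f x) = F (u i) - F (l i)" for i
    using bochner'[of i] approx(4)[of i]
    by (simp add: interval_integral_Icc set_lebesgue_integral_def has_bochner_integral_iff)
  have "(\<lambda>x. F (l x)) \<longlonglongrightarrow> A"
    using A approx unfolding tendsto_at_iff_sequentially comp_def
    by (force elim!: allE[of _ "\<lambda>i. ereal (l i)"])
  moreover have "(\<lambda>x. F (u x)) \<longlonglongrightarrow> B"
    using B approx unfolding tendsto_at_iff_sequentially comp_def
    by (force elim!: allE[of _ "\<lambda>i. ereal (u i)"])
  ultimately have lim: "(\<lambda>i. LBINT x=l i..u i. f x) \<longlonglongrightarrow> B - A"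
    by (simp add: FTC tendsto_diff)
  have ae: "AE x in lborel. a < ereal x \<longrightarrow> ereal x < b \<longrightarrow> 0 \<le> f x"
    using f_nonneg by (auto simp: einterval_iff)
  show ?int ?eq
    by (rule interval_integral_Icc_approx_nonneg[OF \<open>a < b\<close> approx int ae meas lim])+
qed

lemma convex_einterval: "convex (einterval a b)"
  by (cases a; cases b) (auto simp: is_interval_convex_1[symmetric] is_interval_1 einterval_iff)

lemma df_on_has_deriv:
  assumes "df_on a b H" "\<theta> \<in> einterval a b"
  shows "DERIV H \<theta> :> deriv H \<theta>"
proof -
  have "H differentiable (at \<theta>)"
    using assms differentiable_on_eq_differentiable_at[OF open_einterval]
    by (auto simp: df_on_def)
  then show ?thesis
    using DERIV_deriv_iff_real_differentiable by blast
qed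

lemma df_on_deriv_nonneg:
  assumes "df_on a b H" "\<theta> \<in> einterval a b"
  shows "deriv H \<theta> \<ge> 0"
  using assms
  by (intro mono_on_imp_deriv_nonneg[of "einterval a b", OF _ df_on_has_deriv[OF assms]])
     (auto simp: df_on_def interior_open strict_mono_on_imp_mono_on)

text \<open>
  A differentiable distribution function is recovered by integrating its derivative; in particular
  it is absolutely continuous.
\<close>

lemma df_on_integral_deriv:
  assumes H: "df_on a b H" and "a < b"
  shows "set_integrable lborel (einterval a b) (deriv H)"
    and "(LBINT x=a..b. deriv H x) = 1"
    and "\<theta> \<in> einterval a b \<Longrightarrow> (LBINT x=a..ereal \<theta>. deriv H x) = H \<theta>"
proof -
  note FTC = interval_integral_FTC_nonneg_derivative[where F = H and f = "deriv H"]
  have lim: "((H \<circ> real_of_ereal) \<longlongrightarrow> 0) (at_right a)" "((H \<circ> real_of_ereal) \<longlongrightarrow> 1) (at_left b)"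
    using H by (auto simp: df_on_def)
  show "set_integrable lborel (einterval a b) (deriv H)"
    using FTC(1)[OF \<open>a < b\<close> df_on_has_deriv[OF H] df_on_deriv_nonneg[OF H] lim] by simp
  show "(LBINT x=a..b. deriv H x) = 1"
    using FTC(2)[OF \<open>a < b\<close> df_on_has_deriv[OF H] df_on_deriv_nonneg[OF H] lim] by simp
  assume \<theta>: "\<theta> \<in> einterval a b"
  then have sub: "x \<in> einterval a b" if "x \<in> einterval a (ereal \<theta>)" for x
    using that by (cases b) (auto simp: einterval_iff)
  have "isCont H \<theta>"
    using df_on_has_deriv[OF H \<theta>] by (rule DERIV_isCont)
  then have "(H \<longlongrightarrow> H \<theta>) (at_left \<theta>)"
    unfolding isCont_def by (rule filterlim_mono[OF _ order_refl at_le]) simp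
  then have "((H \<circ> real_of_ereal) \<longlongrightarrow> H \<theta>) (at_left (ereal \<theta>))"
    by (simp add: ereal_tendsto_simps)
  then show "(LBINT x=a..ereal \<theta>. deriv H x) = H \<theta>"
    using FTC(2)[OF _ df_on_has_deriv[OF H sub] df_on_deriv_nonneg[OF H sub] lim(1), of "ereal \<theta>" "H \<theta>"] \<theta>
    by (simp add: einterval_iff)
qed

section \<open>Integrals of integrands with one sign change\<close>

lemma einterval_subset_einterval:
  "a \<le> c \<Longrightarrow> d \<le> b \<Longrightarrow> einterval c d \<subseteq> einterval a b"
  by (auto simp: einterval_iff)

text \<open>
  Strict positivity on a nonempty open subinterval is enough, because such an interval is not a
  null set.
\<close>

lemma interval_integral_pos:
  fixes f :: "real \<Rightarrow> real" and a b c d :: ereal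
  assumes f: "set_integrable lborel (einterval a b) f"
    and nonneg: "\<And>x. x \<in> einterval a b \<Longrightarrow> 0 \<le> f x"
    and order: "a \<le> c" "c < d" "d \<le> b"
    and pos: "\<And>x. x \<in> einterval c d \<Longrightarrow> 0 < f x"
  shows "0 < (LBINT x=a..b. f x)"
proof -
  let ?g = "\<lambda>x. indicator (einterval a b) x *\<^sub>R f x"
  have g: "integrable lborel ?g" and ge: "AE x in lborel. 0 \<le> ?g x"
    using f nonneg by (auto simp: set_integrable_def indicator_def)
  have eq: "(LBINT x=a..b. f x) = integral\<^sup>L lborel ?g"
    using order by (simp add: interval_lebesgue_integral_def set_lebesgue_integral_def)
  have "integral\<^sup>L lborel ?g \<noteq> 0"
  proof
    assume "integral\<^sup>L lborel ?g = 0"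
    then have "AE x in lborel. ?g x = 0"
      using integral_nonneg_eq_0_iff_AE[OF g ge] by simp
    then have "AE x in lborel. x \<notin> einterval c d"
    proof eventually_elim
      case (elim x)
      then show ?case
        using pos[of x] einterval_subset_einterval[OF order(1,3)] by (auto simp: indicator_def)
    qed
    then have "einterval c d \<in> null_sets lborel"
      by (subst AE_iff_null_sets) auto
    moreover obtain z where "z \<in> einterval c d"
      using einterval_nonempty[OF order(2)] by auto
    ultimately show False
      using open_not_negligible[OF open_einterval] null_sets_completionI negligible_iff_null_sets
      by blast
  qed
  moreover have "integral\<^sup>L lborel ?g \<ge> 0"
    by (rule integral_nonneg_AE[OF ge])
  ultimately show ?thesis
    using eq by simp
qed

text \<open>
  This is the analytic core. As \<open>\<phi>\<close> decreases and \<open>w \<phi>\<close> has integral zero, \<open>\<phi>\<close> must take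
  positive values near the left end, and once negative it stays negative. If \<open>\<phi>\<close> is still nonnegative
  at \<open>\<theta>\<close>, the integral up to \<open>\<theta>\<close> is that of a nonnegative integrand which is positive near the
  left end. Otherwise the integral from \<open>\<theta>\<close> on is negative, and the one up to \<open>\<theta>\<close> is its opposite.
\<close>

lemma interval_integral_antimono_weight_pos:
  fixes w \<phi> :: "real \<Rightarrow> real" and a b :: ereal
  assumes int: "set_integrable lborel (einterval a b) (\<lambda>x. w x * \<phi> x)"
    and w: "\<And>x. x \<in> einterval a b \<Longrightarrow> 0 < w x"
    and \<phi>: "antimono_on (einterval a b) \<phi>"
    and zero: "(LBINT x=a..b. w x * \<phi> x) = 0"
    and nz: "\<exists>x\<in>einterval a b. \<phi> x \<noteq> 0"
    and \<theta>: "\<theta> \<in> einterval a b"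
  shows "0 < (LBINT x=a..ereal \<theta>. w x * \<phi> x)"
proof -
  have ab: "a < ereal \<theta>" "ereal \<theta> < b"
    using \<theta> by (auto simp: einterval_iff)
  have anti: "\<phi> y \<le> \<phi> x" if "x \<in> einterval a b" "y \<in> einterval a b" "x \<le> y" for x y
    using \<phi> that by (auto simp: monotone_on_def)
  have int_sub: "set_integrable lborel (einterval c d) (\<lambda>x. w x * \<phi> x)" if "a \<le> c" "d \<le> b" for c d
    by (rule set_integrable_subset[OF int]) (use that einterval_subset_einterval in auto)
  have neg: "(LBINT x=c..b. w x * \<phi> x) < 0"
    if "a \<le> c" "v \<in> einterval c b" "\<phi> v < 0" and np: "\<And>x. x \<in> einterval c b \<Longrightarrow> \<phi> x \<le> 0" for c v
  proof -
    have "0 < (LBINT x=c..b. - (w x * \<phi> x))"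
    proof (rule interval_integral_pos[where c = "ereal v" and d = b])
      show "set_integrable lborel (einterval c b) (\<lambda>x. - (w x * \<phi> x))"
        using int_sub[OF that(1), of b] by (simp add: set_integrable_def)
      show "0 \<le> - (w x * \<phi> x)" if "x \<in> einterval c b" for x
      proof -
        have "w x > 0"
          using that \<open>a \<le> c\<close> by (intro w) (auto simp: einterval_iff)
        then show ?thesis
          using np[OF that] by (simp add: mult_le_0_iff)
      qed
      show "0 < - (w x * \<phi> x)" if "x \<in> einterval v b" for x
      proof -
        have v: "v \<in> einterval a b"
          using \<open>a \<le> c\<close> \<open>v \<in> einterval c b\<close> by (auto simp: einterval_iff)
        have x: "x \<in> einterval a b" "v \<le> x"
          using that v less_trans[of a "ereal v" "ereal x"] by (auto simp: einterval_iff)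
        then show ?thesis
          using anti[OF v x] w[OF x(1)] \<open>\<phi> v < 0\<close> by (simp add: mult_less_0_iff)
      qed
    qed (use \<open>v \<in> _\<close> in \<open>auto simp: einterval_iff\<close>)
    then show ?thesis
      by (simp add: interval_lebesgue_integral_uminus)
  qed
  \<comment> \<open>Without a positive value the whole integral would be negative, since \<open>\<phi>\<close> is not zero.\<close>
  obtain u where u: "u \<in> einterval a b" "0 < \<phi> u"
  proof (rule ccontr)
    assume "\<not> thesis"
    then have "\<phi> x \<le> 0" if "x \<in> einterval a b" for x
      using that \<open>\<And>u. \<lbrakk>u \<in> einterval a b; 0 < \<phi> u\<rbrakk> \<Longrightarrow> thesis\<close> not_less by blast
    moreover obtain v where "v \<in> einterval a b" "\<phi> v \<noteq> 0"
      using nz by auto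
    ultimately show False
      using neg[of a v] zero by (simp add: less_le)
  qed
  show ?thesis
  proof (cases "\<phi> \<theta> \<ge> 0")
    case True
    show ?thesis
    proof (rule interval_integral_pos[where c = a and d = "ereal (min u \<theta>)"])
      show "set_integrable lborel (einterval a (ereal \<theta>)) (\<lambda>x. w x * \<phi> x)"
        using int_sub ab by simp
      show "0 \<le> w x * \<phi> x" if "x \<in> einterval a (ereal \<theta>)" for x
      proof -
        have "x \<in> einterval a b" "x \<le> \<theta>"
          using that \<theta> less_trans[of "ereal x" "ereal \<theta>" b] by (auto simp: einterval_iff)
        then show ?thesis
          using w[of x] anti[of x \<theta>] \<theta> True by simp
      qed
      show "0 < w x * \<phi> x" if "x \<in> einterval a (ereal (min u \<theta>))" for x
      proof -
        have "x \<in> einterval a b" "x \<le> u"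
          using that u less_trans[of "ereal x" "ereal u" b] by (auto simp: einterval_iff)
        then show ?thesis
          using w[of x] anti[of x u] u by simp
      qed
    qed (use u ab in \<open>auto simp: einterval_iff min_def\<close>)
  next
    case False
    then obtain v where v: "v \<in> einterval \<theta> b"
      using ab einterval_nonempty by blast
    have "\<phi> x < 0" if "x \<in> einterval \<theta> b" for x
      using anti[of \<theta> x] that \<theta> False less_trans[of a "ereal \<theta>" "ereal x"] by (auto simp: einterval_iff)
    then have "(LBINT x=ereal \<theta>..b. w x * \<phi> x) < 0"
      using v ab by (intro neg[of _ v]) (auto intro: less_imp_le)
    moreover have "(LBINT x=a..ereal \<theta>. w x * \<phi> x) + (LBINT x=ereal \<theta>..b. w x * \<phi> x) = 0"
      using ab int zero
      by (subst interval_integral_sum) (auto simp: interval_lebesgue_integrable_def min_def max_def)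
    ultimately show ?thesis
      by simp
  qed
qed

section \<open>The two fiducial distributions and their geometric mean\<close>

lemma left_fiducial_eq: "left_fiducial p s \<theta> = right_fiducial p s \<theta> + pmf (p \<theta>) s"
proof -
  have "{..s} = {..<s} \<union> {s}"
    by auto
  then have "measure_pmf.prob (p \<theta>) {..s} = measure_pmf.prob (p \<theta>) {..<s} + pmf (p \<theta>) s"
    using measure_pmf.finite_measure_Union[of "{..<s}" "p \<theta>" "{s}"] by (simp add: measure_pmf_single)
  then show ?thesis
    by (simp add: left_fiducial_def right_fiducial_def cdf_def)
qed

lemma left_density_eq:
  assumes "df_on a b (right_fiducial p s)" "df_on a b (left_fiducial p s)"
    and "\<theta> \<in> einterval a b" "right_density p s \<theta> > 0"
  shows "DERIV (\<lambda>t. pmf (p t) s) \<theta> :> left_density p s \<theta> - right_density p s \<theta>"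
    and "left_density p s \<theta> = right_density p s \<theta> * (1 + fid_gamma p s \<theta>)"
proof -
  have eq: "(\<lambda>t. pmf (p t) s) = (\<lambda>t. left_fiducial p s t - right_fiducial p s t)"
    by (simp add: left_fiducial_eq)
  show D: "DERIV (\<lambda>t. pmf (p t) s) \<theta> :> left_density p s \<theta> - right_density p s \<theta>"
    unfolding eq left_density_def right_density_def
    using assms by (intro DERIV_diff df_on_has_deriv)
  show "left_density p s \<theta> = right_density p s \<theta> * (1 + fid_gamma p s \<theta>)"
    using assms(4) DERIV_imp_deriv[OF D] by (simp add: fid_gamma_def field_simps)
qed

text \<open>
  If \<open>l = h (1 + \<gamma>)\<close> were not positive at some point, then, \<open>\<gamma>\<close> being decreasing, it would not be
  positive anywhere to the right of it. The left distribution function could then not increase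
  strictly there.
\<close>

lemma left_density_pos:
  assumes R: "df_on a b (right_fiducial p s)" and L: "df_on a b (left_fiducial p s)"
    and h: "\<And>\<theta>. \<theta> \<in> einterval a b \<Longrightarrow> right_density p s \<theta> > 0"
    and \<gamma>: "antimono_on (einterval a b) (fid_gamma p s)"
    and \<theta>: "\<theta> \<in> einterval a b"
  shows "left_density p s \<theta> > 0"
proof (rule ccontr)
  assume "\<not> left_density p s \<theta> > 0"
  then have "1 + fid_gamma p s \<theta> \<le> 0"
    using left_density_eq(2)[OF R L \<theta> h[OF \<theta>]] h[OF \<theta>] by (simp add: zero_less_mult_iff)
  moreover have "fid_gamma p s x \<le> fid_gamma p s \<theta>" if "x \<in> einterval a b" "\<theta> \<le> x" for x
    using \<gamma> \<theta> that by (auto simp: monotone_on_def)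
  ultimately have le: "left_density p s x \<le> 0" if "x \<in> einterval a b" "\<theta> \<le> x" for x
    using left_density_eq(2)[OF R L that(1) h] h[OF that(1)] that by (fastforce simp: mult_le_0_iff)
  obtain y where y: "\<theta> < y" "ereal y < b"
    using einterval_nonempty[of "ereal \<theta>" b] \<theta> by (auto simp: einterval_iff)
  have sub: "x \<in> einterval a b" if "\<theta> \<le> x" "x \<le> y" for x
    using that \<theta> y by (cases a; cases b) (auto simp: einterval_iff)
  have "left_fiducial p s y \<le> left_fiducial p s \<theta>"
    using y sub le df_on_has_deriv[OF L]
    by (intro DERIV_nonpos_imp_nonincreasing[of \<theta> y]) (auto simp: left_density_def)
  moreover have "left_fiducial p s \<theta> < left_fiducial p s y"
    using L sub[of \<theta>] sub[of y] y by (auto simp: df_on_def monotone_on_def)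
  ultimately show False
    by simp
qed

text \<open>
  If \<open>\<gamma>\<close> had the constant value \<open>k\<close>, the left distribution function minus \<open>1 + k\<close> times the right
  one would be constant. Its limits at the two ends are \<open>0\<close> and \<open>- k\<close>, so \<open>k = 0\<close> and the two
  distribution functions would coincide; but their difference is the probability of \<open>s\<close>.
\<close>

lemma fid_gamma_not_constant:
  assumes "a < b" and s: "s \<in> fiducial_points a b p"
    and h: "\<And>\<theta>. \<theta> \<in> einterval a b \<Longrightarrow> right_density p s \<theta> > 0"
  shows "\<exists>\<theta>\<in>einterval a b. fid_gamma p s \<theta> \<noteq> k"
proof (rule ccontr)
  assume "\<not> ?thesis"
  then have k: "fid_gamma p s \<theta> = k" if "\<theta> \<in> einterval a b" for \<theta>
    using that by blast
  have R: "df_on a b (right_fiducial p s)" and L: "df_on a b (left_fiducial p s)"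
    using s by (auto simp: fiducial_points_def)
  let ?D = "\<lambda>\<theta>. left_fiducial p s \<theta> - (1 + k) * right_fiducial p s \<theta>"
  have "DERIV ?D \<theta> :> 0" if "\<theta> \<in> einterval a b" for \<theta>
    using left_density_eq(2)[OF R L that h[OF that]] k[OF that] that
    by (auto intro!: derivative_eq_intros df_on_has_deriv[OF L] df_on_has_deriv[OF R]
        simp: left_density_def right_density_def)
  then have "\<exists>d. \<forall>\<theta>\<in>einterval a b. ?D \<theta> = d"
    by (intro has_field_derivative_zero_constant)
       (auto intro: has_field_derivative_at_within convex_einterval)
  then obtain d where d: "?D \<theta> = d" if "\<theta> \<in> einterval a b" for \<theta>
    by blast
  have evr: "\<forall>\<^sub>F x in at_right a. (?D \<circ> real_of_ereal) x = d"
    unfolding eventually_at_right[OF \<open>a < b\<close>]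
  proof (intro exI[of _ b] conjI allI impI \<open>a < b\<close>)
    fix y assume "a < y" "y < b"
    then show "(?D \<circ> real_of_ereal) y = d"
      using d by (cases y) (auto simp: einterval_iff)
  qed
  have evl: "\<forall>\<^sub>F x in at_left b. (?D \<circ> real_of_ereal) x = d"
    unfolding eventually_at_left[OF \<open>a < b\<close>]
  proof (intro exI[of _ a] conjI allI impI \<open>a < b\<close>)
    fix y assume "a < y" "y < b"
    then show "(?D \<circ> real_of_ereal) y = d"
      using d by (cases y) (auto simp: einterval_iff)
  qed
  have nontrivial: "at_right a \<noteq> bot" "at_left b \<noteq> bot"
    using dense \<open>a < b\<close>
    by (auto simp: trivial_limit_def eventually_at_right[OF \<open>a < b\<close>] eventually_at_left[OF \<open>a < b\<close>])
  have "((?D \<circ> real_of_ereal) \<longlongrightarrow> 0 - (1 + k) * 0) (at_right a)"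
    using R L unfolding df_on_def comp_def by (intro tendsto_intros) auto
  then have "d = 0"
    using tendsto_unique[OF nontrivial(1) _ tendsto_eventually[OF evr]] by fastforce
  moreover have "((?D \<circ> real_of_ereal) \<longlongrightarrow> 1 - (1 + k) * 1) (at_left b)"
    using R L unfolding df_on_def comp_def by (intro tendsto_intros) auto
  then have "d = - k"
    using tendsto_unique[OF nontrivial(2) _ tendsto_eventually[OF evl]] by fastforce
  ultimately have "pmf (p \<theta>) s = 0" if "\<theta> \<in> einterval a b" for \<theta>
    using d[OF that] by (simp add: left_fiducial_eq)
  then show False
    using s by (auto simp: fiducial_points_def set_pmf_iff)
qed

theorem proposition3:
  fixes a b :: ereal and p :: "real \<Rightarrow> real pmf" and s :: real
  assumes "a < b"
    and "\<And>x. (\<lambda>\<theta>. pmf (p \<theta>) x) C1_differentiable_on einterval a b"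
    and "s \<in> fiducial_points a b p"
    and "\<And>\<theta>. \<theta> \<in> einterval a b \<Longrightarrow> right_density p s \<theta> > 0"
    and "antimono_on (einterval a b) (fid_gamma p s)"
  shows "\<forall>\<theta>\<in>einterval a b.
    right_fiducial p s \<theta> < geom_fiducial a b p s \<theta> \<and>
    geom_fiducial a b p s \<theta> < left_fiducial p s \<theta>"
proof
  fix \<theta> assume \<theta>: "\<theta> \<in> einterval a b"
  let ?I = "einterval a b"
  define h where "h = right_density p s"
  define l where "l = left_density p s"
  define g where "g x = sqrt (h x * l x)" for x
  define c where "c = geom_const a b p s"
  define \<psi> where "\<psi> x = sqrt (1 + fid_gamma p s x)" for x
  have R: "df_on a b (right_fiducial p s)" and L: "df_on a b (left_fiducial p s)"
    using assms(3) by (auto simp: fiducial_points_def)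
  have h: "h = deriv (right_fiducial p s)" and l: "l = deriv (left_fiducial p s)"
    by (auto simp: h_def l_def right_density_def left_density_def)
  have h_pos: "h x > 0" and l_pos: "l x > 0" if "x \<in> ?I" for x
    using that assms(4) left_density_pos[OF R L assms(4,5)] by (auto simp: h_def l_def)
  have l_eq: "l x = h x * (1 + fid_gamma p s x)" if "x \<in> ?I" for x
    using left_density_eq(2)[OF R L that assms(4)[OF that]] by (simp add: h_def l_def)
  have \<gamma>_pos: "1 + fid_gamma p s x > 0" if "x \<in> ?I" for x
    using l_eq[OF that] h_pos[OF that] l_pos[OF that] by (simp add: zero_less_mult_iff)
  have \<psi>_pos: "\<psi> x > 0" if "x \<in> ?I" for x
    using \<gamma>_pos[OF that] by (simp add: \<psi>_def)
  have g_eq: "g x = h x * \<psi> x" and l_eq': "l x = h x * \<psi> x * \<psi> x" if "x \<in> ?I" for x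
    using l_eq[OF that] h_pos[OF that] \<gamma>_pos[OF that]
    by (simp_all add: g_def \<psi>_def real_sqrt_mult)
  have \<psi>_anti: "antimono_on ?I \<psi>"
    using assms(5) by (auto simp: monotone_on_def \<psi>_def)
  have \<psi>_not_const: "\<exists>x\<in>?I. \<psi> x \<noteq> k" for k
  proof -
    obtain x where x: "x \<in> ?I" "fid_gamma p s x \<noteq> k\<^sup>2 - 1"
      using fid_gamma_not_constant[OF assms(1,3,4)] by blast
    moreover have "(\<psi> x)\<^sup>2 = 1 + fid_gamma p s x"
      using \<gamma>_pos[OF x(1)] by (simp add: \<psi>_def)
    ultimately show ?thesis
      by (intro bexI[of _ x]) auto
  qed
  have h_int: "set_integrable lborel ?I h" and l_int: "set_integrable lborel ?I l"
    unfolding h l using df_on_integral_deriv(1) R L \<open>a < b\<close> by blast+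
  have g_int: "set_integrable lborel ?I g"
  proof (rule set_integrable_bound)
    \<comment> \<open>The geometric mean is dominated by the arithmetic mean.\<close>
    show "set_integrable lborel ?I (\<lambda>x. h x + l x)"
      using h_int l_int by (rule set_integral_add)
    have m: "(\<lambda>x. indicat_real ?I x * h x) \<in> borel_measurable borel"
      "(\<lambda>x. indicat_real ?I x * l x) \<in> borel_measurable borel"
      using h_int l_int by (auto simp: set_integrable_def dest: borel_measurable_integrable)
    have "(\<lambda>x. sqrt ((indicat_real ?I x * h x) * (indicat_real ?I x * l x))) \<in> borel_measurable borel"
      using m by measurable
    moreover have "sqrt ((indicat_real ?I x * h x) * (indicat_real ?I x * l x)) = indicat_real ?I x * g x" for x
      by (auto simp: g_def indicator_def)
    ultimately show "set_borel_measurable lborel ?I g"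
      by (simp add: set_borel_measurable_def)
    show "AE x in lborel. x \<in> ?I \<longrightarrow> norm (g x) \<le> norm (h x + l x)"
    proof (intro AE_I2 impI)
      fix x assume "x \<in> ?I"
      then show "norm (g x) \<le> norm (h x + l x)"
        using h_pos[of x] l_pos[of x] arith_geo_mean_sqrt[of "h x" "l x"] by (simp add: g_def)
    qed
  qed
  have c_eq: "c = (LBINT x=a..b. g x)"
    by (simp add: c_def geom_const_def g_def h_def l_def)
  have c_pos: "c > 0"
    unfolding c_eq
    using h_pos l_pos \<open>a < b\<close> by (intro interval_integral_pos[OF g_int, of a b]) (auto simp: g_def less_imp_le)
  have sub: "einterval a (ereal \<theta>) \<subseteq> ?I" and a\<theta>: "a < ereal \<theta>"
    using \<theta> by (cases b; auto simp: einterval_iff)+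
  have G: "geom_fiducial a b p s \<theta> = (LBINT x=a..ereal \<theta>. g x / c)"
    by (simp add: geom_fiducial_def geom_density_def g_def h_def l_def c_def)
  have ivl: "interval_lebesgue_integrable lborel a d f"
    if "set_integrable lborel ?I f" "d = b \<or> d = ereal \<theta>" for f :: "real \<Rightarrow> real" and d
    using that a\<theta> \<open>a < b\<close> set_integrable_subset[OF that(1), of "einterval a (ereal \<theta>)"] sub
    by (auto simp: interval_lebesgue_integrable_def)
  have cong: "(LBINT x=a..d. f x) = (LBINT x=a..d. f' x)"
    if "\<And>x. x \<in> ?I \<Longrightarrow> f x = f' x" "d = b \<or> d = ereal \<theta>" for f f' :: "real \<Rightarrow> real" and d
    using that a\<theta> \<open>a < b\<close> sub by (intro interval_integral_cong) (auto simp: min_absorb1 max_absorb2 less_imp_le)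

  \<comment> \<open>Both differences of densities are a positive weight times a decreasing function.\<close>
  have eq1: "h x * (\<psi> x / c - 1) = g x / c - h x"
    and eq2: "(h x * \<psi> x) * (\<psi> x - 1 / c) = l x - g x / c" if "x \<in> ?I" for x
    using g_eq[OF that] l_eq'[OF that] by (simp_all add: right_diff_distrib)
  have gc_int: "set_integrable lborel ?I (\<lambda>x. g x / c)"
    using set_integrable_divide[OF g_int] by simp
  have int1: "set_integrable lborel ?I (\<lambda>x. h x * (\<psi> x / c - 1))"
    using set_integral_diff(1)[OF gc_int h_int] eq1
    by (subst set_integrable_cong[OF refl refl eq1]) auto
  have int2: "set_integrable lborel ?I (\<lambda>x. (h x * \<psi> x) * (\<psi> x - 1 / c))"
    using set_integral_diff(1)[OF l_int gc_int] eq2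
    by (subst set_integrable_cong[OF refl refl eq2]) auto
  have split1: "(LBINT x=a..d. h x * (\<psi> x / c - 1)) = (LBINT x=a..d. g x / c) - (LBINT x=a..d. h x)"
    and split2: "(LBINT x=a..d. (h x * \<psi> x) * (\<psi> x - 1 / c)) = (LBINT x=a..d. l x) - (LBINT x=a..d. g x / c)"
    if "d = b \<or> d = ereal \<theta>" for d
  proof -
    note ivls = ivl[OF h_int that] ivl[OF l_int that] ivl[OF gc_int that]
    have "(LBINT x=a..d. h x * (\<psi> x / c - 1)) = (LBINT x=a..d. g x / c - h x)"
      using eq1 that by (rule cong)
    then show "(LBINT x=a..d. h x * (\<psi> x / c - 1)) = (LBINT x=a..d. g x / c) - (LBINT x=a..d. h x)"
      using interval_lebesgue_integral_diff(2)[OF ivls(3,1)] by simp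
    have "(LBINT x=a..d. (h x * \<psi> x) * (\<psi> x - 1 / c)) = (LBINT x=a..d. l x - g x / c)"
      using eq2 that by (rule cong)
    then show "(LBINT x=a..d. (h x * \<psi> x) * (\<psi> x - 1 / c)) = (LBINT x=a..d. l x) - (LBINT x=a..d. g x / c)"
      using interval_lebesgue_integral_diff(2)[OF ivls(2,3)] by simp
  qed
  have total: "(LBINT x=a..b. h x) = 1" "(LBINT x=a..b. l x) = 1" "(LBINT x=a..b. g x / c) = 1"
    using df_on_integral_deriv(2)[OF R \<open>a < b\<close>] df_on_integral_deriv(2)[OF L \<open>a < b\<close>] c_pos
    by (simp_all add: h l c_eq[symmetric])
  have "0 < (LBINT x=a..ereal \<theta>. h x * (\<psi> x / c - 1))"
  proof (rule interval_integral_antimono_weight_pos[OF int1 h_pos _ _ _ \<theta>])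
    show "antimono_on ?I (\<lambda>x. \<psi> x / c - 1)"
      using \<psi>_anti c_pos by (auto simp: monotone_on_def divide_right_mono)
    show "\<exists>x\<in>?I. \<psi> x / c - 1 \<noteq> 0"
      using \<psi>_not_const[of c] c_pos by auto
  qed (use split1[of b] total in simp_all)
  moreover have "0 < (LBINT x=a..ereal \<theta>. (h x * \<psi> x) * (\<psi> x - 1 / c))"
  proof (rule interval_integral_antimono_weight_pos[OF int2 _ _ _ _ \<theta>])
    show "0 < h x * \<psi> x" if "x \<in> ?I" for x
      using h_pos[OF that] \<psi>_pos[OF that] by simp
    show "antimono_on ?I (\<lambda>x. \<psi> x - 1 / c)"
      using \<psi>_anti by (auto simp: monotone_on_def)
    show "\<exists>x\<in>?I. \<psi> x - 1 / c \<noteq> 0"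
      using \<psi>_not_const[of "1 / c"] by auto
  qed (use split2[of b] total in simp_all)
  ultimately show "right_fiducial p s \<theta> < geom_fiducial a b p s \<theta> \<and>
      geom_fiducial a b p s \<theta> < left_fiducial p s \<theta>"
    using split1[of "ereal \<theta>"] split2[of "ereal \<theta>"] G \<theta>
      df_on_integral_deriv(3)[OF R \<open>a < b\<close> \<theta>] df_on_integral_deriv(3)[OF L \<open>a < b\<close> \<theta>]
    by (simp add: h l)
qed

end
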